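(* Let $R$ be a commutative ring with identity, $N$ a submodule of a unital $R$-module $M$, $J$ an ideal of $R$, and $S$ a multiplicatively closed subset of $R$. The following are equivalent: (1) $N$ is an $S$-primary submodule of $M$. (2) $N\Join J$ is an $(S\Join J)$-primary submodule of the $(R\Join J)$-module $M\Join J$. (3) $\overline{N}$ is an $\overline{S}$-primary submodule of the $(R\Join J)$-module $M\Join J$.
   Context: A multiplicatively closed subset of a ring is a non-empty subset closed under multiplication. $(N:_R M)=\{r\in R: rM\subseteq N\}$. $R\Join J=\{(r,r+j): r\in R, j\in J\}$ is a subring of $R\times R$. $M\Join J=\{(m,m')\in M\times M: m-m'\in JM\}$ is an $(R\Join J)$-module via $(r,r+j)(m,m')=(rm,(r+j)m')$. Its submodules $N\Join J=\{(n,m)\in N\times M: n-m\in JM\}$ and $\overline{N}=\{(m,n)\in M\times N: m-n\in JM\}$, and the multiplicatively closed subsets $S\Join J=\{(s,s+j): s\in S, j\in J\}$ and $\overline{S}=\{(r,r+j): r\in R, j\in J, r+j\in S\}$ of $R\Join J$, are used. For a multiplicatively closed subset $T$ of a ring $A$, a submodule $P$ of an $A$-module $X$ is $T$-primary if $(P:_A X)\cap T=\emptyset$ and there exists a fixed $t\in T$ such that for all $a\in A$, $x\in X$, $ax\in P$ implies $ta\in\sqrt{(P:_A X)}$ or $tx\in P$. *)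

theory Defs
  imports "HOL-Algebra.Module" "HOL-Algebra.Ideal" "HOL-Algebra.Chinese_Remainder"
begin

section \<open>$S$-primary submodules\<close>

text \<open>A multiplicatively closed subset need not contain \<open>\<one>\<close>.\<close>

definition mult_closed :: "'a set \<Rightarrow> ('a, 'b) ring_scheme \<Rightarrow> bool" where
  "mult_closed T A \<longleftrightarrow>
     T \<noteq> {} \<and> T \<subseteq> carrier A \<and> (\<forall>s\<in>T. \<forall>t\<in>T. s \<otimes>\<^bsub>A\<^esub> t \<in> T)"

definition colon :: "('a, 'b) ring_scheme \<Rightarrow> ('a, 'c, 'd) module_scheme \<Rightarrow> 'c set \<Rightarrow> 'a set" where
  "colon A X P = {r \<in> carrier A. \<forall>x\<in>carrier X. r \<odot>\<^bsub>X\<^esub> x \<in> P}"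

definition radical :: "('a, 'b) ring_scheme \<Rightarrow> 'a set \<Rightarrow> 'a set" where
  "radical A I = {a \<in> carrier A. \<exists>n::nat. n > 0 \<and> a [^]\<^bsub>A\<^esub> n \<in> I}"

text \<open>
  The standing requirements (\<open>X\<close> is an \<open>A\<close>-module, \<open>T\<close> is multiplicatively closed, \<open>P\<close> is a
  submodule) are part of the predicate.
\<close>

definition S_primary ::
    "('a, 'b) ring_scheme \<Rightarrow> ('a, 'c, 'd) module_scheme \<Rightarrow> 'a set \<Rightarrow> 'c set \<Rightarrow> bool" where
  "S_primary A X T P \<longleftrightarrow>
     Module.module A X \<and> mult_closed T A \<and> submodule P A X \<and>
     colon A X P \<inter> T = {} \<and>
     (\<exists>t\<in>T. \<forall>a\<in>carrier A. \<forall>x\<in>carrier X.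
        a \<odot>\<^bsub>X\<^esub> x \<in> P \<longrightarrow> t \<otimes>\<^bsub>A\<^esub> a \<in> radical A (colon A X P) \<or> t \<odot>\<^bsub>X\<^esub> x \<in> P)"


section \<open>Duplication along an ideal\<close>

text \<open>The submodule \<open>JM\<close>: all finite sums of products \<open>j m\<close> (cf.\ \<^const>\<open>ideal_prod\<close>).\<close>

inductive_set ideal_smult :: "('a, 'c, 'd) module_scheme \<Rightarrow> 'a set \<Rightarrow> 'c set"
  for M and J where
    prod: "\<lbrakk> j \<in> J; m \<in> carrier M \<rbrakk> \<Longrightarrow> j \<odot>\<^bsub>M\<^esub> m \<in> ideal_smult M J"
  | sum: "\<lbrakk> x \<in> ideal_smult M J; y \<in> ideal_smult M J \<rbrakk> \<Longrightarrow> x \<oplus>\<^bsub>M\<^esub> y \<in> ideal_smult M J"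

text \<open>\<open>dup_set R J B\<close> is \<open>B \<Join> J\<close> for a subset \<open>B\<close> of \<open>R\<close>, and \<open>dup_set_bar R J S\<close> is the
  set written \<open>S\<close> with a bar.\<close>

definition dup_set :: "('a, 'b) ring_scheme \<Rightarrow> 'a set \<Rightarrow> 'a set \<Rightarrow> ('a \<times> 'a) set" where
  "dup_set R J B = {(r, r \<oplus>\<^bsub>R\<^esub> j) | r j. r \<in> B \<and> j \<in> J}"

definition dup_set_bar :: "('a, 'b) ring_scheme \<Rightarrow> 'a set \<Rightarrow> 'a set \<Rightarrow> ('a \<times> 'a) set" where
  "dup_set_bar R J S = {(r, r \<oplus>\<^bsub>R\<^esub> j) | r j. r \<in> carrier R \<and> j \<in> J \<and> r \<oplus>\<^bsub>R\<^esub> j \<in> S}"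

definition dup_ring :: "('a, 'b) ring_scheme \<Rightarrow> 'a set \<Rightarrow> ('a \<times> 'a) ring" where
  "dup_ring R J = (RDirProd R R)\<lparr>carrier := dup_set R J (carrier R)\<rparr>"

text \<open>Likewise \<open>dup_sub M J N\<close> is \<open>N \<Join> J\<close> and \<open>dup_sub_bar M J N\<close> is \<open>N\<close> with a bar.\<close>

definition dup_sub :: "('a, 'c, 'd) module_scheme \<Rightarrow> 'a set \<Rightarrow> 'c set \<Rightarrow> ('c \<times> 'c) set" where
  "dup_sub M J N = {(n, m). n \<in> N \<and> m \<in> carrier M \<and> n \<ominus>\<^bsub>M\<^esub> m \<in> ideal_smult M J}"

definition dup_sub_bar :: "('a, 'c, 'd) module_scheme \<Rightarrow> 'a set \<Rightarrow> 'c set \<Rightarrow> ('c \<times> 'c) set" where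
  "dup_sub_bar M J N = {(m, n). m \<in> carrier M \<and> n \<in> N \<and> m \<ominus>\<^bsub>M\<^esub> n \<in> ideal_smult M J}"

text \<open>The fields \<open>mult\<close> and \<open>one\<close>, inherited from the ring record, are irrelevant for a module.\<close>

definition dup_module :: "('a, 'c, 'd) module_scheme \<Rightarrow> 'a set \<Rightarrow> ('a \<times> 'a, 'c \<times> 'c) module" where
  "dup_module M J =
     \<lparr> carrier = dup_sub M J (carrier M),
       mult = undefined,
       one = undefined,
       zero = (\<zero>\<^bsub>M\<^esub>, \<zero>\<^bsub>M\<^esub>),
       add = (\<lambda>(x, y) (x', y'). (x \<oplus>\<^bsub>M\<^esub> x', y \<oplus>\<^bsub>M\<^esub> y')),
       smult = (\<lambda>(r, r') (x, y). (r \<odot>\<^bsub>M\<^esub> x, r' \<odot>\<^bsub>M\<^esub> y)) \<rparr>"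

end

theory Submission
  imports Defs
begin

text \<open>
  The sets \<open>N \<Join> J\<close> and \<open>S \<Join> J\<close> are the preimages of \<open>N\<close> and \<open>S\<close> under the first projections
  \<open>M \<Join> J \<rightarrow> M\<close> and \<open>R \<Join> J \<rightarrow> R\<close>; the barred sets are the preimages under the second projections.
  Being primary in this sense transfers both ways along a surjective semilinear map over a
  surjective ring homomorphism, since taking preimages commutes with the colon ideal and the radical.
\<close>

section \<open>Preimages under semilinear surjections\<close>

text \<open>A ring homomorphism commutes with powers, so the same exponent \<open>n\<close>
  witnesses membership in both radicals.\<close>

lemma radical_vimage:
  assumes "cring A" "cring R" "h \<in> ring_hom A R"
  shows "radical A {a \<in> carrier A. h a \<in> I} = {a \<in> carrier A. h a \<in> radical R I}"
proof -
  interpret A: cring A by fact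
  interpret R: cring R by fact
  have "h (a [^]\<^bsub>A\<^esub> n) = h a [^]\<^bsub>R\<^esub> n" if "a \<in> carrier A" for a and n :: nat
    using that assms(3)
    by (induction n) (auto simp: ring_hom_one ring_hom_mult)
  then show ?thesis
    unfolding radical_def using ring_hom_closed[OF assms(3)] by auto
qed

text \<open>One abstraction covers both projections of the duplication: it is instantiated once with
  \<open>fst\<close> for \<open>h\<close> and \<open>F\<close> and once with \<open>snd\<close>, so
  the transfer argument is carried out a single time.\<close>

locale semilinear_surjection = A: Module.module A X + R: Module.module R M
  for A (structure) and X (structure) and R (structure) and M (structure) +
  fixes h F
  assumes h_hom: "h \<in> ring_hom A R"
    and h_surj: "h ` carrier A = carrier R"
    and F_surj: "F ` carrier X = carrier M"
    and F_add: "\<lbrakk> x \<in> carrier X; y \<in> carrier X \<rbrakk> \<Longrightarrow> F (x \<oplus>\<^bsub>X\<^esub> y) = F x \<oplus>\<^bsub>M\<^esub> F y"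
    and F_smult: "\<lbrakk> a \<in> carrier A; x \<in> carrier X \<rbrakk> \<Longrightarrow> F (a \<odot>\<^bsub>X\<^esub> x) = h a \<odot>\<^bsub>M\<^esub> F x"
begin

lemma h_closed: "a \<in> carrier A \<Longrightarrow> h a \<in> carrier R"
  using h_surj by blast

lemma F_closed: "x \<in> carrier X \<Longrightarrow> F x \<in> carrier M"
  using F_surj by blast

text \<open>Additivity between groups forces \<open>F\<close> to preserve zero and negatives, as
  closure of preimages requires.\<close>

sublocale F: group_hom "add_monoid X" "add_monoid M" F
proof (intro group_hom.intro group_hom_axioms.intro)
  show "F \<in> hom (add_monoid X) (add_monoid M)"
    by (auto simp: hom_def F_closed F_add)
qed (simp_all add: A.a_group R.a_group)

text \<open>Because \<open>F\<close> is onto, it suffices to test \<open>h a\<close> on the values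
  \<open>F x\<close>, where semilinearity identifies the product with the value of \<open>F\<close>
  at \<open>a\<close> times \<open>x\<close>.\<close>

lemma colon_vimage:
  "colon A X {x \<in> carrier X. F x \<in> N} = {a \<in> carrier A. h a \<in> colon R M N}"
proof -
  have "(\<forall>x\<in>carrier X. a \<odot>\<^bsub>X\<^esub> x \<in> carrier X \<and> F (a \<odot>\<^bsub>X\<^esub> x) \<in> N) \<longleftrightarrow>
        (\<forall>y\<in>carrier M. h a \<odot>\<^bsub>M\<^esub> y \<in> N)" if "a \<in> carrier A" for a
    \<comment> \<open>Read from right to left, \<open>F_surj\<close> turns the quantifier over
      \<open>carrier M\<close> into one over \<open>carrier X\<close>.\<close>
    using that by (simp add: F_smult flip: F_surj)
  then show ?thesis
    unfolding colon_def using h_closed by auto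
qed

lemma mult_closed_vimage:
  assumes "mult_closed S R"
  shows "mult_closed {a \<in> carrier A. h a \<in> S} A"
proof -
  \<comment> \<open>Surjectivity of \<open>h\<close> is what makes the preimage non-empty.\<close>
  obtain s where "s \<in> S" "s \<in> h ` carrier A"
    using assms unfolding mult_closed_def h_surj by blast
  then have "\<exists>a\<in>carrier A. h a \<in> S"
    by blast
  then show ?thesis
    using assms unfolding mult_closed_def by (auto simp: ring_hom_mult[OF h_hom])
qed

lemma submodule_vimage:
  assumes "submodule N R M"
  shows "submodule {x \<in> carrier X. F x \<in> N} A X"
proof (rule A.submoduleI)
  note N = R.submoduleE[OF assms]
  have zero: "\<zero>\<^bsub>M\<^esub> \<in> N"
    using subgroup.one_closed[OF submodule.axioms(1)[OF assms]] by simp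
  show "\<zero>\<^bsub>X\<^esub> \<in> {x \<in> carrier X. F x \<in> N}"
    using zero F.hom_one by simp
  show "\<ominus>\<^bsub>X\<^esub> x \<in> {x \<in> carrier X. F x \<in> N}" if "x \<in> {x \<in> carrier X. F x \<in> N}" for x
    using that N(3) F.hom_inv[of x] by (simp add: a_inv_def)
  show "x \<oplus>\<^bsub>X\<^esub> y \<in> {x \<in> carrier X. F x \<in> N}"
    if "x \<in> {x \<in> carrier X. F x \<in> N}" "y \<in> {x \<in> carrier X. F x \<in> N}" for x y
    using that N(5) by (simp add: F_add)
  show "a \<odot>\<^bsub>X\<^esub> x \<in> {x \<in> carrier X. F x \<in> N}"
    if "a \<in> carrier A" "x \<in> {x \<in> carrier X. F x \<in> N}" for a x
    using that N(4) by (simp add: F_smult h_closed)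
qed auto

text \<open>The standing requirements hold on both sides, so only the disjointness and the existence
  of the fixed element have to be compared.\<close>

lemma S_primary_vimage_iff:
  assumes "mult_closed S R" "submodule N R M"
  shows "S_primary A X {a \<in> carrier A. h a \<in> S} {x \<in> carrier X. F x \<in> N} \<longleftrightarrow>
         S_primary R M S N"
proof -
  let ?T = "{a \<in> carrier A. h a \<in> S}" and ?P = "{x \<in> carrier X. F x \<in> N}"
  let ?I = "colon R M N"
  have S: "S \<subseteq> carrier R"
    using assms(1) by (simp add: mult_closed_def)
  \<comment> \<open>Both sets are preimages under \<open>h\<close>, so they meet exactly when some
    value of \<open>h\<close> lies in \<open>?I\<close> and in \<open>S\<close>.\<close>
  have "colon A X ?P \<inter> ?T = {} \<longleftrightarrow> (\<forall>r\<in>h ` carrier A. r \<notin> ?I \<inter> S)"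
    unfolding colon_vimage by blast
  then have disj: "colon A X ?P \<inter> ?T = {} \<longleftrightarrow> ?I \<inter> S = {}"
    unfolding h_surj using S by blast
  have rad: "radical A (colon A X ?P) = {a \<in> carrier A. h a \<in> radical R ?I}"
    by (simp add: colon_vimage radical_vimage[OF A.is_cring R.is_cring h_hom])
  have witness:
    "(\<forall>a\<in>carrier A. \<forall>x\<in>carrier X. a \<odot>\<^bsub>X\<^esub> x \<in> ?P \<longrightarrow>
        t \<otimes>\<^bsub>A\<^esub> a \<in> radical A (colon A X ?P) \<or> t \<odot>\<^bsub>X\<^esub> x \<in> ?P) \<longleftrightarrow>
     (\<forall>r\<in>carrier R. \<forall>m\<in>carrier M. r \<odot>\<^bsub>M\<^esub> m \<in> N \<longrightarrow>
        h t \<otimes>\<^bsub>R\<^esub> r \<in> radical R ?I \<or> h t \<odot>\<^bsub>M\<^esub> m \<in> N)" if "t \<in> carrier A" for t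
    unfolding rad using that
    by (simp add: F_smult ring_hom_mult[OF h_hom] flip: F_surj h_surj)
  have "(\<exists>t\<in>?T. \<forall>a\<in>carrier A. \<forall>x\<in>carrier X. a \<odot>\<^bsub>X\<^esub> x \<in> ?P \<longrightarrow>
           t \<otimes>\<^bsub>A\<^esub> a \<in> radical A (colon A X ?P) \<or> t \<odot>\<^bsub>X\<^esub> x \<in> ?P) \<longleftrightarrow>
        (\<exists>t\<in>?T. \<forall>r\<in>carrier R. \<forall>m\<in>carrier M. r \<odot>\<^bsub>M\<^esub> m \<in> N \<longrightarrow>
           h t \<otimes>\<^bsub>R\<^esub> r \<in> radical R ?I \<or> h t \<odot>\<^bsub>M\<^esub> m \<in> N)"
    by (rule bex_cong[OF refl]) (use witness in blast)
  \<comment> \<open>The condition on \<open>t\<close> involves only \<open>h t\<close>, so the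
    search can run over the image of \<open>?T\<close>, which is all of \<open>S\<close> because
    \<open>h\<close> is onto.\<close>
  also have "\<dots> \<longleftrightarrow> (\<exists>s\<in>h ` ?T. \<forall>r\<in>carrier R. \<forall>m\<in>carrier M. r \<odot>\<^bsub>M\<^esub> m \<in> N \<longrightarrow>
           s \<otimes>\<^bsub>R\<^esub> r \<in> radical R ?I \<or> s \<odot>\<^bsub>M\<^esub> m \<in> N)"
    by blast
  also have "h ` ?T = h ` carrier A \<inter> S"
    by blast
  also have "\<dots> = S"
    unfolding h_surj using S by blast
  finally show ?thesis
    unfolding S_primary_def
    using disj A.module_axioms R.module_axioms mult_closed_vimage submodule_vimage assms
    by simp
qed

end

section \<open>The duplication as a module\<close>

lemma dup_ring_simps [simp]:
  "carrier (dup_ring R J) = dup_set R J (carrier R)"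
  "(r, s) \<otimes>\<^bsub>dup_ring R J\<^esub> (r', s') = (r \<otimes>\<^bsub>R\<^esub> r', s \<otimes>\<^bsub>R\<^esub> s')"
  "(r, s) \<oplus>\<^bsub>dup_ring R J\<^esub> (r', s') = (r \<oplus>\<^bsub>R\<^esub> r', s \<oplus>\<^bsub>R\<^esub> s')"
  "\<one>\<^bsub>dup_ring R J\<^esub> = (\<one>\<^bsub>R\<^esub>, \<one>\<^bsub>R\<^esub>)"
  "\<zero>\<^bsub>dup_ring R J\<^esub> = (\<zero>\<^bsub>R\<^esub>, \<zero>\<^bsub>R\<^esub>)"
  by (simp_all add: dup_ring_def RDirProd_def DirProd_def monoid.defs)

lemma dup_module_simps [simp]:
  "carrier (dup_module M J) = dup_sub M J (carrier M)"
  "(x, y) \<oplus>\<^bsub>dup_module M J\<^esub> (x', y') = (x \<oplus>\<^bsub>M\<^esub> x', y \<oplus>\<^bsub>M\<^esub> y')"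
  "(r, s) \<odot>\<^bsub>dup_module M J\<^esub> (x, y) = (r \<odot>\<^bsub>M\<^esub> x, s \<odot>\<^bsub>M\<^esub> y)"
  "\<zero>\<^bsub>dup_module M J\<^esub> = (\<zero>\<^bsub>M\<^esub>, \<zero>\<^bsub>M\<^esub>)"
  by (simp_all add: dup_module_def)

section \<open>Duplicated sets as preimages under the projections\<close>

lemma dup_sub_bar_eq_vimage_snd:
  assumes "N \<subseteq> carrier M"
  shows "dup_sub_bar M J N = {x \<in> dup_sub M J (carrier M). snd x \<in> N}"
  using assms by (auto simp: dup_sub_def dup_sub_bar_def)

lemma dup_sub_eq_vimage_fst:
  assumes "N \<subseteq> carrier M"
  shows "dup_sub M J N = {x \<in> dup_sub M J (carrier M). fst x \<in> N}"
  using assms by (auto simp: dup_sub_def)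

lemma dup_set_eq_vimage_fst:
  assumes "S \<subseteq> carrier R"
  shows "dup_set R J S = {a \<in> dup_set R J (carrier R). fst a \<in> S}"
  using assms by (auto simp: dup_set_def)

lemma dup_set_bar_eq_vimage_snd:
  "dup_set_bar R J S = {a \<in> dup_set R J (carrier R). snd a \<in> S}"
  by (auto simp: dup_set_def dup_set_bar_def)

section \<open>The duplicated ring\<close>

locale module_ideal = Module.module R M + ideal J R
  for R (structure) and M (structure) and J
begin

text \<open>The parameter \<open>j\<close> is recovered as \<open>s \<ominus> r\<close>; closure
  questions thereby become questions about differences lying in \<open>J\<close>.\<close>

lemma mem_dup_set:
  "(r, s) \<in> dup_set R J (carrier R) \<longleftrightarrow> r \<in> carrier R \<and> s \<in> carrier R \<and> s \<ominus> r \<in> J"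
proof -
  have "r \<oplus> j \<ominus> r = j" if "r \<in> carrier R" "j \<in> carrier R" for j
    using that by algebra
  moreover have "s = r \<oplus> (s \<ominus> r)" if "r \<in> carrier R" "s \<in> carrier R"
    using that by algebra
  ultimately show ?thesis
    unfolding dup_set_def using a_subset by auto
qed

text \<open>The diagonal supplies zero and one of the duplicated ring, and later the surjectivity of
  both projections.\<close>

lemma diag_mem_dup_set: "r \<in> carrier R \<Longrightarrow> (r, r) \<in> dup_set R J (carrier R)"
  by (simp add: mem_dup_set R.minus_eq R.r_neg)

text \<open>The ring identities hold componentwise; the ideal \<open>J\<close> enters only through
  the closure conditions.\<close>

lemma cring_dup_ring: "cring (dup_ring R J)"
proof (rule cringI)
  show "abelian_group (dup_ring R J)"
  proof (rule abelian_groupI)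
    fix x y assume "x \<in> carrier (dup_ring R J)" "y \<in> carrier (dup_ring R J)"
    then obtain r s r' s' where xy: "x = (r, s)" "y = (r', s')"
      and R: "r \<in> carrier R" "s \<in> carrier R" "r' \<in> carrier R" "s' \<in> carrier R"
      and J: "s \<ominus> r \<in> J" "s' \<ominus> r' \<in> J"
      by (cases x; cases y) (auto simp: mem_dup_set)
    have "(s \<oplus> s') \<ominus> (r \<oplus> r') = (s \<ominus> r) \<oplus> (s' \<ominus> r')"
      using R by algebra
    with J show "x \<oplus>\<^bsub>dup_ring R J\<^esub> y \<in> carrier (dup_ring R J)"
      using R by (simp add: xy mem_dup_set)
  next
    fix x assume "x \<in> carrier (dup_ring R J)"
    then obtain r s where x: "x = (r, s)"
      and R: "r \<in> carrier R" "s \<in> carrier R" and J: "s \<ominus> r \<in> J"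
      by (cases x) (auto simp: mem_dup_set)
    have "\<ominus> s \<ominus> \<ominus> r = \<ominus> (s \<ominus> r)"
      using R by algebra
    with J R have "(\<ominus> r, \<ominus> s) \<in> carrier (dup_ring R J)"
      by (simp add: mem_dup_set)
    then show "\<exists>y\<in>carrier (dup_ring R J). y \<oplus>\<^bsub>dup_ring R J\<^esub> x = \<zero>\<^bsub>dup_ring R J\<^esub>"
      using R by (intro bexI[of _ "(\<ominus> r, \<ominus> s)"]) (simp_all add: x R.l_neg)
  qed (use diag_mem_dup_set in \<open>auto simp: mem_dup_set R.a_ac\<close>)
  show "comm_monoid (dup_ring R J)"
  proof (rule comm_monoidI)
    fix x y assume "x \<in> carrier (dup_ring R J)" "y \<in> carrier (dup_ring R J)"
    then obtain r s r' s' where xy: "x = (r, s)" "y = (r', s')"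
      and R: "r \<in> carrier R" "s \<in> carrier R" "r' \<in> carrier R" "s' \<in> carrier R"
      and J: "s \<ominus> r \<in> J" "s' \<ominus> r' \<in> J"
      by (cases x; cases y) (auto simp: mem_dup_set)
    \<comment> \<open>Inserting the mixed product \<open>s \<otimes> r'\<close> writes the
      difference as a sum of two multiples of elements of \<open>J\<close>.\<close>
    have "s \<otimes> s' \<ominus> r \<otimes> r' = s \<otimes> (s' \<ominus> r') \<oplus> (s \<ominus> r) \<otimes> r'"
      using R by algebra
    with J show "x \<otimes>\<^bsub>dup_ring R J\<^esub> y \<in> carrier (dup_ring R J)"
      using R by (simp add: xy mem_dup_set I_l_closed I_r_closed)
  qed (use diag_mem_dup_set in \<open>auto simp: mem_dup_set R.m_ac\<close>)
qed (auto simp: mem_dup_set R.l_distr)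

section \<open>The submodule \<open>JM\<close> and the duplicated module\<close>

lemma ideal_smult_closed: "x \<in> ideal_smult M J \<Longrightarrow> x \<in> carrier M"
  by (induction rule: ideal_smult.induct) (use a_subset in auto)

text \<open>Scalars are absorbed into the factor from \<open>J\<close> of each product. Zero is the
  product of the two zeros, and negatives come from the scalar
  \<open>\<ominus> \<one>\<close>.\<close>

lemma submodule_ideal_smult: "submodule (ideal_smult M J) R M"
proof (rule submoduleI)
  show "\<zero>\<^bsub>M\<^esub> \<in> ideal_smult M J"
    using ideal_smult.prod[of \<zero> J "\<zero>\<^bsub>M\<^esub>" M] zero_closed by simp
  show "r \<odot>\<^bsub>M\<^esub> x \<in> ideal_smult M J" if "r \<in> carrier R" "x \<in> ideal_smult M J" for r x
    using that(2)
  proof induction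
    case (prod j m)
    then have "r \<odot>\<^bsub>M\<^esub> (j \<odot>\<^bsub>M\<^esub> m) = (r \<otimes> j) \<odot>\<^bsub>M\<^esub> m"
      using that(1) a_subset by (auto simp: smult_assoc1)
    then show ?case
      using prod that(1) by (simp add: ideal_smult.prod I_l_closed)
  next
    case (sum x y)
    then show ?case
      using that(1) by (simp add: smult_r_distr ideal_smult_closed ideal_smult.sum)
  qed
  then show "\<ominus>\<^bsub>M\<^esub> x \<in> ideal_smult M J" if "x \<in> ideal_smult M J" for x
    using that smult_l_minus[of \<one> x] ideal_smult_closed[OF that]
    by (metis R.a_inv_closed R.one_closed smult_one)
qed (auto simp: ideal_smult_closed ideal_smult.sum)

text \<open>The difference is first minus second here, opposite to \<open>mem_dup_set\<close>; this
  explains the mixed signs in the closure of scalar multiplication.\<close>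

lemma mem_dup_sub:
  "(x, y) \<in> dup_sub M J (carrier M) \<longleftrightarrow>
    x \<in> carrier M \<and> y \<in> carrier M \<and> x \<ominus>\<^bsub>M\<^esub> y \<in> ideal_smult M J"
  by (simp add: dup_sub_def)

lemma zero_mem_ideal_smult: "\<zero>\<^bsub>M\<^esub> \<in> ideal_smult M J"
  using subgroup.one_closed[OF submodule.axioms(1)[OF submodule_ideal_smult]] by simp

lemma diag_mem_dup_sub: "x \<in> carrier M \<Longrightarrow> (x, x) \<in> dup_sub M J (carrier M)"
  by (simp add: mem_dup_sub M.minus_eq M.r_neg zero_mem_ideal_smult)

lemma abelian_group_dup_module: "abelian_group (dup_module M J)"
proof (rule abelian_groupI)
  note JM = submoduleE[OF submodule_ideal_smult]
  fix u v assume "u \<in> carrier (dup_module M J)" "v \<in> carrier (dup_module M J)"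
  then obtain x y x' y' where uv: "u = (x, y)" "v = (x', y')"
    and M: "x \<in> carrier M" "y \<in> carrier M" "x' \<in> carrier M" "y' \<in> carrier M"
    and d: "x \<ominus>\<^bsub>M\<^esub> y \<in> ideal_smult M J" "x' \<ominus>\<^bsub>M\<^esub> y' \<in> ideal_smult M J"
    by (cases u; cases v) (auto simp: mem_dup_sub)
  have "(x \<oplus>\<^bsub>M\<^esub> x') \<ominus>\<^bsub>M\<^esub> (y \<oplus>\<^bsub>M\<^esub> y') = (x \<ominus>\<^bsub>M\<^esub> y) \<oplus>\<^bsub>M\<^esub> (x' \<ominus>\<^bsub>M\<^esub> y')"
    using M by (simp add: M.minus_eq M.minus_add M.a_ac)
  with d show "u \<oplus>\<^bsub>dup_module M J\<^esub> v \<in> carrier (dup_module M J)"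
    using M by (simp add: uv mem_dup_sub JM(5))
next
  note JM = submoduleE[OF submodule_ideal_smult]
  fix u assume "u \<in> carrier (dup_module M J)"
  then obtain x y where u: "u = (x, y)"
    and M: "x \<in> carrier M" "y \<in> carrier M" and d: "x \<ominus>\<^bsub>M\<^esub> y \<in> ideal_smult M J"
    by (cases u) (auto simp: mem_dup_sub)
  have "\<ominus>\<^bsub>M\<^esub> x \<ominus>\<^bsub>M\<^esub> \<ominus>\<^bsub>M\<^esub> y = \<ominus>\<^bsub>M\<^esub> (x \<ominus>\<^bsub>M\<^esub> y)"
    using M by (simp add: M.minus_eq M.minus_add)
  with d M have "(\<ominus>\<^bsub>M\<^esub> x, \<ominus>\<^bsub>M\<^esub> y) \<in> carrier (dup_module M J)"
    by (simp add: mem_dup_sub JM(3))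
  then show "\<exists>v\<in>carrier (dup_module M J). v \<oplus>\<^bsub>dup_module M J\<^esub> u = \<zero>\<^bsub>dup_module M J\<^esub>"
    using M by (intro bexI[of _ "(\<ominus>\<^bsub>M\<^esub> x, \<ominus>\<^bsub>M\<^esub> y)"]) (simp_all add: u M.l_neg)
qed (use diag_mem_dup_sub in \<open>auto simp: mem_dup_sub M.a_ac\<close>)

lemma module_dup: "Module.module (dup_ring R J) (dup_module M J)"
proof (rule moduleI)
  note JM = submoduleE[OF submodule_ideal_smult]
  fix a u assume "a \<in> carrier (dup_ring R J)" "u \<in> carrier (dup_module M J)"
  then obtain r s x y where au: "a = (r, s)" "u = (x, y)"
    and R: "r \<in> carrier R" "s \<in> carrier R" "s \<ominus> r \<in> J"
    and M: "x \<in> carrier M" "y \<in> carrier M" "x \<ominus>\<^bsub>M\<^esub> y \<in> ideal_smult M J"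
    by (cases a; cases u) (auto simp: mem_dup_set mem_dup_sub)
  \<comment> \<open>Inserting \<open>r\<close> times \<open>y\<close> separates the two differences:
    one term is a scalar multiple of an element of \<open>JM\<close>, the other has its coefficient
    \<open>s \<ominus> r\<close> in \<open>J\<close>.\<close>
  have "r \<odot>\<^bsub>M\<^esub> x \<ominus>\<^bsub>M\<^esub> s \<odot>\<^bsub>M\<^esub> y = r \<odot>\<^bsub>M\<^esub> (x \<ominus>\<^bsub>M\<^esub> y) \<ominus>\<^bsub>M\<^esub> (s \<ominus> r) \<odot>\<^bsub>M\<^esub> y"
  proof -
    have "s \<odot>\<^bsub>M\<^esub> y = r \<odot>\<^bsub>M\<^esub> y \<oplus>\<^bsub>M\<^esub> (s \<ominus> r) \<odot>\<^bsub>M\<^esub> y"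
    proof -
      have "s = r \<oplus> (s \<ominus> r)"
        using R(1,2) by algebra
      then show ?thesis
        using R M by (metis R.minus_closed smult_l_distr)
    qed
    then show ?thesis
      using R M by (simp add: M.minus_eq M.minus_add M.a_ac smult_r_distr smult_r_minus)
  qed
  moreover have "\<dots> \<in> ideal_smult M J"
    \<comment> \<open>The instance unfolds only the outer subtraction and keeps the difference of
      \<open>x\<close> and \<open>y\<close> intact, so that \<open>M(3)\<close> still
      applies.\<close>
    unfolding M.minus_eq[of "r \<odot>\<^bsub>M\<^esub> (x \<ominus>\<^bsub>M\<^esub> y)"]
    by (intro JM(5) JM(3) JM(4)[OF R(1) M(3)] ideal_smult.prod[OF R(3) M(2)])
  ultimately show "a \<odot>\<^bsub>dup_module M J\<^esub> u \<in> carrier (dup_module M J)"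
    using R M by (simp add: au mem_dup_sub)
qed (auto simp: cring_dup_ring abelian_group_dup_module mem_dup_set mem_dup_sub
      smult_l_distr smult_r_distr smult_assoc1)

section \<open>The two projections as semilinear surjections\<close>

lemma dup_projections:
  "fst ` dup_set R J (carrier R) = carrier R" "snd ` dup_set R J (carrier R) = carrier R"
  "fst ` dup_sub M J (carrier M) = carrier M" "snd ` dup_sub M J (carrier M) = carrier M"
proof -
  \<comment> \<open>Any relation on \<open>A\<close> containing the diagonal projects onto
    \<open>A\<close>; the type is left general so that this serves both the ring and the
    module.\<close>
  have proj: "fst ` D = A" "snd ` D = A"
    if "D \<subseteq> A \<times> A" "\<And>x. x \<in> A \<Longrightarrow> (x, x) \<in> D" for D and A :: "'x set"
    using that by force+
  have "dup_set R J (carrier R) \<subseteq> carrier R \<times> carrier R"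
    "dup_sub M J (carrier M) \<subseteq> carrier M \<times> carrier M"
    by (auto simp: mem_dup_set mem_dup_sub)
  then show "fst ` dup_set R J (carrier R) = carrier R" "snd ` dup_set R J (carrier R) = carrier R"
    "fst ` dup_sub M J (carrier M) = carrier M" "snd ` dup_sub M J (carrier M) = carrier M"
    by (simp_all add: proj diag_mem_dup_set diag_mem_dup_sub)
qed

lemma semilinear_surjection_fst:
  "semilinear_surjection (dup_ring R J) (dup_module M J) R M fst fst"
proof (intro semilinear_surjection.intro semilinear_surjection_axioms.intro)
  show "fst \<in> ring_hom (dup_ring R J) R"
    by (rule ring_hom_memI) (auto simp: mem_dup_set)
qed (auto simp: dup_projections module_dup module_axioms)

lemma semilinear_surjection_snd:
  "semilinear_surjection (dup_ring R J) (dup_module M J) R M snd snd"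
proof (intro semilinear_surjection.intro semilinear_surjection_axioms.intro)
  show "snd \<in> ring_hom (dup_ring R J) R"
    by (rule ring_hom_memI) (auto simp: mem_dup_set)
qed (auto simp: dup_projections module_dup module_axioms)

end

theorem corollary6:
  fixes R :: "('a, 'b) ring_scheme" and M :: "('a, 'c, 'd) module_scheme"
    and N :: "'c set" and J S :: "'a set"
  assumes "cring R" and "Module.module R M" and "submodule N R M"
    and "ideal J R" and "mult_closed S R"
  shows "(S_primary R M S N \<longleftrightarrow>
            S_primary (dup_ring R J) (dup_module M J) (dup_set R J S) (dup_sub M J N)) \<and>
         (S_primary (dup_ring R J) (dup_module M J) (dup_set R J S) (dup_sub M J N) \<longleftrightarrow>
            S_primary (dup_ring R J) (dup_module M J) (dup_set_bar R J S) (dup_sub_bar M J N))"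
proof -
  interpret module_ideal R M J
    by (intro module_ideal.intro assms)
  have N: "N \<subseteq> carrier M"
    using submoduleE(1)[OF assms(3)] .
  have S: "S \<subseteq> carrier R"
    using assms(5) by (simp add: mult_closed_def)
  show ?thesis
    \<comment> \<open>Each duplicated condition is equivalent to the one on \<open>N\<close>, which
      gives their mutual equivalence as well.\<close>
    using semilinear_surjection.S_primary_vimage_iff[OF semilinear_surjection_fst assms(5,3)]
      semilinear_surjection.S_primary_vimage_iff[OF semilinear_surjection_snd assms(5,3)]
    by (simp add: dup_set_eq_vimage_fst[OF S] dup_sub_eq_vimage_fst[OF N]
        dup_set_bar_eq_vimage_snd dup_sub_bar_eq_vimage_snd[OF N])
qed

end
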